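(* Let $\mathbb{K}$ be a field and let $q\in\mathbb{K}$ be nonzero with $q^2\neq1$. For each $i\in\mathbb{Z}_4$ there exists a $\mathbb{K}$-algebra homomorphism from $U_q(\mathfrak{sl}_2)$ to $\boxtimes_q$ that sends $$x\mapsto x_{i,i+2},\qquad x^{-1}\mapsto x_{i+2,i},\qquad y\mapsto x_{i+2,i+3},\qquad z\mapsto x_{i+3,i},$$ where $x^{\pm1},y,z$ are the equitable generators of $U_q(\mathfrak{sl}_2)$.
   Context: Let $[n]_q=\frac{q^n-q^{-n}}{q-q^{-1}}$ and $\mathbb{Z}_4=\mathbb{Z}/4\mathbb{Z}$. The $q$-tetrahedron algebra $\boxtimes_q$ is the unital associative $\mathbb{K}$-algebra with generators $\{x_{ij}\mid i,j\in\mathbb{Z}_4,\ j-i=1\text{ or }j-i=2\}$ and relations: (i) for $i,j\in\mathbb{Z}_4$ with $j-i=2$, $x_{ij}x_{ji}=1$; (ii) for $h,i,j\in\mathbb{Z}_4$ such that $(i-h,j-i)$ is one of $(1,1),(1,2),(2,1)$, $\frac{q x_{hi}x_{ij}-q^{-1}x_{ij}x_{hi}}{q-q^{-1}}=1$; (iii) for $h,i,j,k\in\mathbb{Z}_4$ with $i-h=j-i=k-j=1$, $x_{hi}^3x_{jk}-[3]_q x_{hi}^2x_{jk}x_{hi}+[3]_q x_{hi}x_{jk}x_{hi}^2-x_{jk}x_{hi}^3=0$. $U_q(\mathfrak{sl}_2)$ is the unital associative $\mathbb{K}$-algebra with generators $K^{\pm1},e^{\pm}$ and relations $KK^{-1}=K^{-1}K=1$,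 $Ke^{\pm}K^{-1}=q^{\pm2}e^{\pm}$, $[e^+,e^-]=\frac{K-K^{-1}}{q-q^{-1}}$. It is known to have the following equivalent presentation: generators $x^{\pm1},y,z$ (the equitable generators) with relations $xx^{-1}=x^{-1}x=1$, $\frac{qxy-q^{-1}yx}{q-q^{-1}}=1$, $\frac{qyz-q^{-1}zy}{q-q^{-1}}=1$, $\frac{qzx-q^{-1}xz}{q-q^{-1}}=1$; an isomorphism from this presentation to the first one is $x^{\pm1}\mapsto K^{\pm1}$, $y\mapsto K^{-1}+e^-$, $z\mapsto K^{-1}-K^{-1}e^+q(q-q^{-1})^2$. *)

theory Defs
  imports
    "HOL-Algebra.QuotRing"
    "HOL-Algebra.Module"
    "HOL-Library.Poly_Mapping"
    "HOL-Library.Numeral_Type"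
begin

section \<open>Associative unital algebras given by generators and relations\<close>

text \<open>
  The free monoid, written additively: with the class \<^class>\<open>monoid_add\<close>, the type
  \<open>'g free_mon \<Rightarrow>\<^sub>0 'k\<close> carries the convolution product and hence
  is the free associative unital \<open>'k\<close>-algebra on \<open>'g\<close>.
\<close>

datatype 'g free_mon = FreeMon "'g list"

instantiation free_mon :: (type) monoid_add
begin

definition zero_free_mon :: "'a free_mon" where
  "0 = FreeMon []"

fun plus_free_mon :: "'a free_mon \<Rightarrow> 'a free_mon \<Rightarrow> 'a free_mon" where
  "FreeMon u + FreeMon v = FreeMon (u @ v)"

instance
proof
  fix a b c :: "'a free_mon"
  show "a + b + c = a + (b + c)" by (cases a; cases b; cases c) simp
  show "0 + a = a" by (cases a) (simp add: zero_free_mon_def)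
  show "a + 0 = a" by (cases a) (simp add: zero_free_mon_def)
qed

end

type_synonym ('g, 'k) free_alg = "'g free_mon \<Rightarrow>\<^sub>0 'k"

definition gen :: "'g \<Rightarrow> ('g, 'k::field) free_alg" where
  "gen g = Poly_Mapping.single (FreeMon [g]) 1"

definition scal :: "'k::field \<Rightarrow> ('g, 'k) free_alg" where
  "scal c = Poly_Mapping.single 0 c"

definition free_algebra :: "('k::field, ('g, 'k) free_alg) module" where
  "free_algebra =
    \<lparr>carrier = UNIV, mult = (*), one = 1, zero = 0, add = (+), smult = (\<lambda>c p. scal c * p)\<rparr>"

text \<open>
  The quotient of the free algebra by the two-sided ideal generated by the relators \<open>R\<close>, that is,
  by the elements \<open>l - r\<close> for the defining relations \<open>l = r\<close>. The scalar action on cosets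
  follows the pattern of \<^const>\<open>rcoset_mult\<close>.
\<close>

definition presented_algebra ::
    "('g, 'k::field) free_alg set \<Rightarrow> ('k, ('g, 'k) free_alg set) module" where
  "presented_algebra R =
    (let I = Idl\<^bsub>free_algebra\<^esub> R; Q = free_algebra Quot I in
      \<lparr>carrier = carrier Q, mult = mult Q, one = one Q, zero = zero Q, add = add Q,
       smult = (\<lambda>c X. \<Union>p\<in>X. I +>\<^bsub>free_algebra\<^esub> (c \<odot>\<^bsub>free_algebra\<^esub> p))\<rparr>)"

definition pres_class ::
    "('g, 'k::field) free_alg set \<Rightarrow> ('g, 'k) free_alg \<Rightarrow> ('g, 'k) free_alg set" where
  "pres_class R p = Idl\<^bsub>free_algebra\<^esub> R +>\<^bsub>free_algebra\<^esub> p"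

text \<open>Homomorphisms of unital algebras over the field given by the type \<open>'k\<close>.\<close>

definition alg_hom ::
    "('k, 'a, 'm) module_scheme \<Rightarrow> ('k, 'b, 'n) module_scheme \<Rightarrow> ('a \<Rightarrow> 'b) set" where
  "alg_hom A B =
    {h \<in> ring_hom A B. \<forall>c. \<forall>a\<in>carrier A. h (c \<odot>\<^bsub>A\<^esub> a) = c \<odot>\<^bsub>B\<^esub> h a}"

definition qint :: "'k::field \<Rightarrow> int \<Rightarrow> 'k" where
  "qint q n = (q powi n - q powi (- n)) / (q - inverse q)"


section \<open>The \<open>q\<close>-tetrahedron algebra\<close>

text \<open>The numeral type \<^typ>\<open>4\<close> is the ring of integers modulo 4.\<close>

typedef tet_index = "{p :: 4 \<times> 4. snd p - fst p = 1 \<or> snd p - fst p = 2}"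
  by (rule exI[of _ "(0, 1)"]) simp

text \<open>Meaningful only if \<open>j - i\<close> is 1 or 2; otherwise the value is unspecified.\<close>

definition tet_gen :: "4 \<Rightarrow> 4 \<Rightarrow> (tet_index, 'k::field) free_alg" where
  "tet_gen i j = gen (Abs_tet_index (i, j))"

definition tet_relators :: "'k::field \<Rightarrow> (tet_index, 'k) free_alg set" where
  "tet_relators q =
    {tet_gen i j * tet_gen j i - 1 | i j. j - i = 2}
    \<union> {scal (inverse (q - inverse q)) *
          (scal q * tet_gen h i * tet_gen i j - scal (inverse q) * tet_gen i j * tet_gen h i) - 1
        | h i j. (i - h, j - i) \<in> {(1, 1), (1, 2), (2, 1)}}
    \<union> {tet_gen h i ^ 3 * tet_gen j k
          - scal (qint q 3) * tet_gen h i ^ 2 * tet_gen j k * tet_gen h i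
          + scal (qint q 3) * tet_gen h i * tet_gen j k * tet_gen h i ^ 2
          - tet_gen j k * tet_gen h i ^ 3
        | h i j k. i - h = 1 \<and> j - i = 1 \<and> k - j = 1}"

definition tet_algebra :: "'k::field \<Rightarrow> ('k, (tet_index, 'k) free_alg set) module" where
  "tet_algebra q = presented_algebra (tet_relators q)"

definition tet_x :: "'k::field \<Rightarrow> 4 \<Rightarrow> 4 \<Rightarrow> (tet_index, 'k) free_alg set" where
  "tet_x q i j = pres_class (tet_relators q) (tet_gen i j)"


section \<open>The quantum group \<open>U\<^sub>q(sl\<^sub>2)\<close> and its equitable generators\<close>

datatype uq_index = GK | GKinv | Gep | Gem

definition uq_relators :: "'k::field \<Rightarrow> (uq_index, 'k) free_alg set" where
  "uq_relators q =
    {gen GK * gen GKinv - 1,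
     gen GKinv * gen GK - 1,
     gen GK * gen Gep * gen GKinv - scal (q powi 2) * gen Gep,
     gen GK * gen Gem * gen GKinv - scal (q powi (- 2)) * gen Gem,
     (gen Gep * gen Gem - gen Gem * gen Gep)
       - scal (inverse (q - inverse q)) * (gen GK - gen GKinv)}"

definition uq_algebra :: "'k::field \<Rightarrow> ('k, (uq_index, 'k) free_alg set) module" where
  "uq_algebra q = presented_algebra (uq_relators q)"

text \<open>
  The equitable generators of \<open>U\<^sub>q(sl\<^sub>2)\<close>, as elements of the algebra presented by
  \<open>K\<close>, \<open>K\<^sup>-\<^sup>1\<close>, \<open>e\<^sup>+\<close>, \<open>e\<^sup>-\<close>: the images of the generators of the equitable presentation
  under the isomorphism \<open>x \<mapsto> K\<close>, \<open>x\<^sup>-\<^sup>1 \<mapsto> K\<^sup>-\<^sup>1\<close>, \<open>y \<mapsto> K\<^sup>-\<^sup>1 + e\<^sup>-\<close>,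
  \<open>z \<mapsto> K\<^sup>-\<^sup>1 - K\<^sup>-\<^sup>1 e\<^sup>+ q (q - q\<^sup>-\<^sup>1)\<^sup>2\<close>.
\<close>

definition eq_x :: "'k::field \<Rightarrow> (uq_index, 'k) free_alg set" where
  "eq_x q = pres_class (uq_relators q) (gen GK)"

definition eq_x_inv :: "'k::field \<Rightarrow> (uq_index, 'k) free_alg set" where
  "eq_x_inv q = pres_class (uq_relators q) (gen GKinv)"

definition eq_y :: "'k::field \<Rightarrow> (uq_index, 'k) free_alg set" where
  "eq_y q = pres_class (uq_relators q) (gen GKinv + gen Gem)"

definition eq_z :: "'k::field \<Rightarrow> (uq_index, 'k) free_alg set" where
  "eq_z q = pres_class (uq_relators q)
    (gen GKinv - gen GKinv * gen Gep * scal (q * (q - inverse q) ^ 2))"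

end

theory Submission
  imports Defs
begin

text \<open>
  Put \<open>x = x\<^bsub>i,i+2\<^esub>\<close>, \<open>x' = x\<^bsub>i+2,i\<^esub>\<close>, \<open>y = x\<^bsub>i+2,i+3\<^esub>\<close> and \<open>z = x\<^bsub>i+3,i\<^esub>\<close>. The
  triangle \<open>i, i + 2, i + 3\<close> has sides of length 2, 1, 1, so the relations of the tetrahedron
  algebra contain all equitable relations of \<open>U\<^sub>q(sl\<^sub>2)\<close> between \<open>x\<^sup>\<plusminus>\<^sup>1\<close>, \<open>y\<close> and \<open>z\<close>
  (\<open>tet_relations\<close>).

  The algebra \<open>U\<^sub>q(sl\<^sub>2)\<close> is presented here by \<open>K\<^sup>\<plusminus>\<^sup>1\<close> and \<open>e\<^sup>\<plusminus>\<close>, so the equitable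
  generators have to be inverted: with \<open>c = q (q - q\<^sup>-\<^sup>1)\<^sup>2\<close>, the equations
  \<open>y = K\<^sup>-\<^sup>1 + e\<^sup>-\<close> and \<open>z = K\<^sup>-\<^sup>1 - c K\<^sup>-\<^sup>1 e\<^sup>+\<close> force \<open>e\<^sup>- \<mapsto> y - x'\<close> and
  \<open>e\<^sup>+ \<mapsto> c\<^sup>-\<^sup>1 (1 - x z)\<close>. By the universal property of a presentation
  (\<open>presented_algebra_hom\<close>) it is enough that the images of the defining relators lie in the
  relation ideal of the tetrahedron algebra. For \<open>x x' - 1\<close> and \<open>x' x - 1\<close> this is immediate, and
  \<open>chevalley_relations\<close> writes the others explicitly as combinations of equitable relators.
\<close>

section \<open>Substitution homomorphisms between free algebras\<close>

lemma scal_simps: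
  "scal 0 = 0" "scal 1 = 1" "scal (a + b) = scal a + scal b"
  "scal (a * b) = scal a * scal b" "scal (a - b) = scal a - scal b"
  by (simp_all add: scal_def single_add mult_single single_diff)

lemma poly_mapping_single_induct [case_names zero single add]:
  fixes p :: "'a \<Rightarrow>\<^sub>0 'b::monoid_add"
  assumes "P 0" and "\<And>w c. P (Poly_Mapping.single w c)"
    and "\<And>p r. P p \<Longrightarrow> P r \<Longrightarrow> P (p + r)"
  shows "P p"
proof (induction p rule: update_induct)
  case const
  show ?case by (rule assms)
next
  case (update f a b)
  have "Poly_Mapping.update a b f = f + Poly_Mapping.single a b"
    using update.hyps
    by (intro poly_mapping_eqI)
      (auto simp: lookup_update lookup_add lookup_single when_def in_keys_iff)
  with update.IH assms show ?case by simp
qed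

lemma scal_commute: "p * scal c = scal c * p"
  by (induction p rule: poly_mapping_single_induct)
    (simp_all add: scal_def mult_single distrib_left distrib_right mult.commute)

fun word_subst :: "('g \<Rightarrow> ('h, 'k::field) free_alg) \<Rightarrow> 'g free_mon \<Rightarrow> ('h, 'k) free_alg" where
  "word_subst f (FreeMon u) = prod_list (map f u)"

text \<open>
  The algebra homomorphism that extends an assignment of the generators: the universal property of
  the free algebra, with another free algebra as the target.
\<close>

definition subst :: "('g \<Rightarrow> ('h, 'k::field) free_alg) \<Rightarrow> ('g, 'k) free_alg \<Rightarrow> ('h, 'k) free_alg" where
  "subst f p = (\<Sum>w\<in>Poly_Mapping.keys p. scal (Poly_Mapping.lookup p w) * word_subst f w)"

lemma word_subst_add: "word_subst f (v + w) = word_subst f v * word_subst f w"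
  by (cases v; cases w) simp

lemma subst_single: "subst f (Poly_Mapping.single w c) = scal c * word_subst f w"
  by (simp add: subst_def scal_simps)

lemma subst_zero [simp]: "subst f 0 = 0"
  by (simp add: subst_def)

lemma subst_add [simp]: "subst f (p + r) = subst f p + subst f r"
  unfolding subst_def
  by (rule setsum_keys_plus_distrib) (simp_all add: scal_simps distrib_right)

lemma subst_mult [simp]: "subst f (p * r) = subst f p * subst f r"
proof (induction p rule: poly_mapping_single_induct)
  case (single v c)
  show ?case
  proof (induction r rule: poly_mapping_single_induct)
    case (single w d)
    have "word_subst f v * (scal d * word_subst f w) = scal d * word_subst f v * word_subst f w"
      by (simp only: mult.assoc [symmetric] scal_commute)
    then show ?case
      by (simp add: mult_single subst_single word_subst_add scal_simps mult.assoc)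
  qed (simp_all add: distrib_left)
qed (simp_all add: distrib_right)

lemma subst_scal [simp]: "subst f (scal c) = scal c"
  by (simp add: scal_def subst_single zero_free_mon_def)

lemma subst_one [simp]: "subst f 1 = 1"
  using subst_scal[of f 1] by (simp add: scal_simps)

lemma subst_diff [simp]: "subst f (p - r) = subst f p - subst f r"
  using subst_add[of f "p - r" r] by simp

lemma subst_gen [simp]: "subst f (gen g) = f g"
  by (simp add: gen_def subst_single scal_simps)


section \<open>Homomorphisms out of a presented algebra\<close>

lemma free_algebra_simps [simp]:
  "carrier free_algebra = UNIV" "p \<otimes>\<^bsub>free_algebra\<^esub> r = p * r" "\<one>\<^bsub>free_algebra\<^esub> = 1"
  "\<zero>\<^bsub>free_algebra\<^esub> = 0" "p \<oplus>\<^bsub>free_algebra\<^esub> r = p + r" "c \<odot>\<^bsub>free_algebra\<^esub> p = scal c * p"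
  by (simp_all add: free_algebra_def)

lemma ring_free_algebra: "ring free_algebra"
proof (rule ringI)
  show "abelian_group free_algebra"
  proof (rule abelian_groupI)
    show "\<exists>r\<in>carrier free_algebra. r \<oplus>\<^bsub>free_algebra\<^esub> p = \<zero>\<^bsub>free_algebra\<^esub>" for p
      by (rule bexI[of _ "- p"]) simp_all
  qed (simp_all add: add_ac)
  show "Group.monoid free_algebra"
    by (rule monoidI) (simp_all add: mult.assoc)
qed (simp_all add: distrib_left distrib_right)

interpretation free_algebra: ring free_algebra
  by (rule ring_free_algebra)

text \<open>
  Ideal membership below is handled with the type class operations of the free algebra, where
  ring identities are decided by rewriting; the lemmas up to \<open>presented_algebra_smult\<close> translate
  the quotient algebra and its cosets into this form.
\<close>

abbreviation rel_ideal :: "('g, 'k::field) free_alg set \<Rightarrow> ('g, 'k) free_alg set" where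
  "rel_ideal R \<equiv> Idl\<^bsub>free_algebra\<^esub> R"

lemma ideal_rel_ideal: "ideal (rel_ideal R) free_algebra"
  by (rule free_algebra.genideal_ideal) simp

lemma rel_ideal_relator: "p \<in> R \<Longrightarrow> p \<in> rel_ideal R"
  using free_algebra.genideal_self[of R] by auto

lemma free_algebra_a_inv: "\<ominus>\<^bsub>free_algebra\<^esub> p = - p"
  by (rule free_algebra.minus_equality) simp_all

lemma rel_ideal_closed:
  shows rel_ideal_zero: "0 \<in> rel_ideal R"
    and rel_ideal_add: "p \<in> rel_ideal R \<Longrightarrow> r \<in> rel_ideal R \<Longrightarrow> p + r \<in> rel_ideal R"
    and rel_ideal_uminus: "p \<in> rel_ideal R \<Longrightarrow> - p \<in> rel_ideal R"
    and rel_ideal_mult_left: "p \<in> rel_ideal R \<Longrightarrow> a * p \<in> rel_ideal R"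
    and rel_ideal_mult_right: "p \<in> rel_ideal R \<Longrightarrow> p * a \<in> rel_ideal R"
proof -
  interpret ideal "rel_ideal R" free_algebra by (rule ideal_rel_ideal)
  show "0 \<in> rel_ideal R"
    using zero_closed by simp
  show "p + r \<in> rel_ideal R" if "p \<in> rel_ideal R" "r \<in> rel_ideal R"
    using a_closed[OF that] by simp
  show "- p \<in> rel_ideal R" if "p \<in> rel_ideal R"
    using a_inv_closed[OF that] by (simp add: free_algebra_a_inv)
  show "a * p \<in> rel_ideal R" "p * a \<in> rel_ideal R" if "p \<in> rel_ideal R"
    using I_l_closed[OF that, of a] I_r_closed[OF that, of a] by simp_all
qed

lemma rel_ideal_diff: "p \<in> rel_ideal R \<Longrightarrow> r \<in> rel_ideal R \<Longrightarrow> p - r \<in> rel_ideal R"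
  using rel_ideal_add[of p R "- r"] rel_ideal_uminus[of r R] by simp

lemma mem_pres_class: "r \<in> pres_class R p \<longleftrightarrow> r - p \<in> rel_ideal R"
  by (force simp: pres_class_def a_r_coset_def' intro: bexI[of _ "r - p"])

lemma pres_class_eq_iff: "pres_class R p = pres_class R r \<longleftrightarrow> p - r \<in> rel_ideal R"
proof
  assume "pres_class R p = pres_class R r"
  then show "p - r \<in> rel_ideal R"
    using mem_pres_class[of p R p] mem_pres_class[of p R r] rel_ideal_zero[of R] by simp
next
  assume *: "p - r \<in> rel_ideal R"
  have "s - p \<in> rel_ideal R \<longleftrightarrow> s - r \<in> rel_ideal R" for s
    using rel_ideal_add[OF _ *, of "s - p"] rel_ideal_diff[OF _ *, of "s - r"] by auto
  then show "pres_class R p = pres_class R r"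
    by (simp add: set_eq_iff mem_pres_class)
qed

lemma presented_algebra_simps:
  "carrier (presented_algebra R) = range (pres_class R)"
  "\<one>\<^bsub>presented_algebra R\<^esub> = pres_class R 1"
  "pres_class R p \<oplus>\<^bsub>presented_algebra R\<^esub> pres_class R r = pres_class R (p + r)"
  "pres_class R p \<otimes>\<^bsub>presented_algebra R\<^esub> pres_class R r = pres_class R (p * r)"
proof -
  interpret ideal "rel_ideal R" free_algebra by (rule ideal_rel_ideal)
  show "carrier (presented_algebra R) = range (pres_class R)"
    by (auto simp: presented_algebra_def Let_def FactRing_def A_RCOSETS_def' pres_class_def)
  show "\<one>\<^bsub>presented_algebra R\<^esub> = pres_class R 1"
    by (simp add: presented_algebra_def Let_def FactRing_def pres_class_def)
  show "pres_class R p \<oplus>\<^bsub>presented_algebra R\<^esub> pres_class R r = pres_class R (p + r)"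
    using a_rcos_sum[of p r]
    by (simp add: presented_algebra_def Let_def FactRing_def pres_class_def)
  show "pres_class R p \<otimes>\<^bsub>presented_algebra R\<^esub> pres_class R r = pres_class R (p * r)"
    using rcoset_mult_add[of p r]
    by (simp add: presented_algebra_def Let_def FactRing_def pres_class_def)
qed

lemma presented_algebra_smult:
  "c \<odot>\<^bsub>presented_algebra R\<^esub> pres_class R p = pres_class R (scal c * p)"
proof -
  have "pres_class R (scal c * r) = pres_class R (scal c * p)" if "r \<in> pres_class R p" for r
    using rel_ideal_mult_left[of "r - p" R "scal c"] that
    by (simp add: pres_class_eq_iff mem_pres_class right_diff_distrib)
  moreover have "p \<in> pres_class R p"
    by (simp add: mem_pres_class rel_ideal_zero)
  ultimately have "(\<Union>r\<in>pres_class R p. pres_class R (scal c * r)) = pres_class R (scal c * p)"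
    by blast
  then show ?thesis
    by (simp add: presented_algebra_def Let_def pres_class_def)
qed

text \<open>
  The preimage of an ideal under the homomorphism is an ideal, so if it contains the relators, it
  contains the ideal that they generate.
\<close>

lemma subst_rel_ideal:
  assumes "\<And>r. r \<in> R \<Longrightarrow> subst f r \<in> rel_ideal S" and "p \<in> rel_ideal R"
  shows "subst f p \<in> rel_ideal S"
proof -
  have uminus: "subst f (- a) = - subst f a" for a
    using subst_diff[of f 0 a] by simp
  have "ideal {p. subst f p \<in> rel_ideal S} free_algebra"
  proof (rule idealI[OF ring_free_algebra])
    show "subgroup {p. subst f p \<in> rel_ideal S} (add_monoid free_algebra)"
      by (rule free_algebra.add.subgroupI)
        (auto simp: free_algebra_a_inv uminus rel_ideal_closed intro: exI[of _ 0])
  qed (simp_all add: rel_ideal_closed)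
  then have "rel_ideal R \<subseteq> {p. subst f p \<in> rel_ideal S}"
    by (rule free_algebra.genideal_minimal) (use assms(1) in blast)
  with assms(2) show ?thesis by blast
qed

text \<open>
  The universal property of a presentation. The map is defined on a coset through an arbitrary
  representative; the choice does not matter because relations go to relations.
\<close>

lemma presented_algebra_hom:
  assumes "\<And>r. r \<in> R \<Longrightarrow> subst f r \<in> rel_ideal S"
  shows "\<exists>h \<in> alg_hom (presented_algebra R) (presented_algebra S).
    \<forall>p. h (pres_class R p) = pres_class S (subst f p)"
proof -
  define h where "h X = pres_class S (subst f (SOME p. X = pres_class R p))" for X
  have h: "h (pres_class R p) = pres_class S (subst f p)" for p
  proof -
    define r where "r = (SOME r. pres_class R p = pres_class R r)"
    have "pres_class R r = pres_class R p"
      unfolding r_def by (rule someI [THEN sym]) (rule refl)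
    then have "subst f (r - p) \<in> rel_ideal S"
      by (intro subst_rel_ideal[OF assms]) (simp_all only: pres_class_eq_iff[symmetric])
    then have "pres_class S (subst f r) = pres_class S (subst f p)"
      by (simp add: pres_class_eq_iff)
    then show ?thesis
      by (simp only: h_def r_def)
  qed
  have "h \<in> alg_hom (presented_algebra R) (presented_algebra S)"
    unfolding alg_hom_def
    by (auto simp: presented_algebra_simps presented_algebra_smult h intro!: ring_hom_memI)
  with h show ?thesis by blast
qed


section \<open>Chevalley relations from equitable relations\<close>

text \<open>
  Here \<open>s\<close> stands for the scalar \<open>q\<close> and \<open>s'\<close> for \<open>q\<^sup>-\<^sup>1\<close>; \<open>a, b\<close> are the relators that say
  that \<open>x'\<close> inverts \<open>x\<close>, and \<open>r1, r2, r3\<close> are the equitable relators multiplied by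
  \<open>q - q\<^sup>-\<^sup>1\<close>. The left-hand sides are the relators for \<open>K e\<^sup>+ K\<^sup>-\<^sup>1\<close>, \<open>K e\<^sup>- K\<^sup>-\<^sup>1\<close> and
  \<open>[e\<^sup>+, e\<^sup>-]\<close> at \<open>K = x\<close>, \<open>e\<^sup>- = y - x'\<close>, \<open>c e\<^sup>+ = 1 - x z\<close>, the first and
  the last multiplied by \<open>c = q (q - q\<^sup>-\<^sup>1)\<^sup>2\<close>. The right-hand sides come from
  solving the equitable relations for \<open>x z x'\<close>, \<open>x y x'\<close> and \<open>y x\<close> and keeping track of the
  relators used. For instance, \<open>r3\<close> gives \<open>x z x' = q\<^sup>2 z - (q\<^sup>2 - 1) x'\<close>, hence
  \<open>x (1 - x z) x' = q\<^sup>2 (1 - x z)\<close>. In the commutator, \<open>b\<close>, \<open>r1\<close> and \<open>r3\<close> reduce everything to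
  \<open>x (q\<^sup>2 y z - z y) - (q\<^sup>2 - 1) x'\<close>, and \<open>r2\<close> turns this into \<open>(q\<^sup>2 - 1) (x - x')\<close>.
\<close>

lemma chevalley_relations:
  fixes s s' x x' y z :: "'a::ring_1"
  assumes central: "\<And>p. p * s = s * p" "\<And>p. p * s' = s' * p"
    and inverse: "s * s' = 1"
  defines "a \<equiv> x * x' - 1" and "b \<equiv> x' * x - 1"
    and "r1 \<equiv> s * x * y - s' * y * x - (s - s')"
    and "r2 \<equiv> s * y * z - s' * z * y - (s - s')"
    and "r3 \<equiv> s * z * x - s' * x * z - (s - s')"
  shows "x * (1 - x * z) * x' - s * s * (1 - x * z) =
      s * x * r3 * x' - s * s * x * z * a + s * s * a" (is ?raise)
    and "x * (y - x') * x' - s' * s' * (y - x') = s' * r1 * x' - a * x' + s' * s' * y * a" (is ?lower)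
    and "(1 - x * z) * (y - x') - (y - x') * (1 - x * z) - (s * s - 1) * (x - x') =
      s * x * r2 - s * r3 * x' - s * r1 * z + s * s * z * a - b * z" (is ?comm)
proof -
  have inverse': "s' * s = 1"
    using inverse central(1)[of s'] by simp
  have cancel: "s * (s' * p) = p" "s' * (s * p) = p" for p
    by (simp_all add: mult.assoc [symmetric] inverse inverse')
  have left: "g * (s * p) = s * (g * p)" "g * (s' * p) = s' * (g * p)" for g p
    by (simp_all add: mult.assoc [symmetric] central[of g])
  \<comment> \<open>The centrality rules are instantiated at the noncentral letters only: applied to \<open>s\<close> and
    \<open>s'\<close> themselves they would rewrite forever.\<close>
  note move = central[of x] central[of x'] central[of y] central[of z]
    left[of x] left[of x'] left[of y] left[of z]
  show ?raise ?lower ?comm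
    unfolding a_def b_def r1_def r2_def r3_def
    by (simp_all add: algebra_simps move cancel inverse inverse')
qed

text \<open>
  The hypotheses on \<open>q\<close> make \<open>q - q\<^sup>-\<^sup>1\<close> invertible, which allows the denominator of the
  equitable relation to be cleared.
\<close>

lemma tet_relations:
  fixes q :: "'k::field" and i j h :: 4
  shows tet_inverse: "j - i = 2 \<Longrightarrow> tet_gen i j * tet_gen j i - 1 \<in> rel_ideal (tet_relators q)"
    and tet_equitable: "(i - h, j - i) \<in> {(1, 1), (1, 2), (2, 1)} \<Longrightarrow> q \<noteq> 0 \<Longrightarrow> q ^ 2 \<noteq> 1 \<Longrightarrow>
      scal q * tet_gen h i * tet_gen i j - scal (inverse q) * tet_gen i j * tet_gen h i
        - (scal q - scal (inverse q)) \<in> rel_ideal (tet_relators q)"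
proof -
  show "tet_gen i j * tet_gen j i - 1 \<in> rel_ideal (tet_relators q)" if "j - i = 2"
    by (rule rel_ideal_relator) (use that in \<open>auto simp: tet_relators_def\<close>)
  assume ij: "(i - h, j - i) \<in> {(1, 1), (1, 2), (2, 1)}" and "q \<noteq> 0" "q ^ 2 \<noteq> 1"
  then have unit: "(q - inverse q) * inverse (q - inverse q) = 1"
    by (auto simp: field_simps power2_eq_square)
  define m where "m = scal q * tet_gen h i * tet_gen i j - scal (inverse q) * tet_gen i j * tet_gen h i"
  have "scal (inverse (q - inverse q)) * m - 1 \<in> rel_ideal (tet_relators q)"
    unfolding m_def by (rule rel_ideal_relator) (use ij in \<open>unfold tet_relators_def, blast\<close>)
  then have "scal (q - inverse q) * (scal (inverse (q - inverse q)) * m - 1) \<in> rel_ideal (tet_relators q)"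
    by (rule rel_ideal_mult_left)
  also have "scal (q - inverse q) * (scal (inverse (q - inverse q)) * m - 1) = m - scal (q - inverse q)"
    by (simp only: right_diff_distrib mult.assoc [symmetric] scal_simps(4) [symmetric] unit)
      (simp add: scal_simps(2))
  finally show "scal q * tet_gen h i * tet_gen i j - scal (inverse q) * tet_gen i j * tet_gen h i
        - (scal q - scal (inverse q)) \<in> rel_ideal (tet_relators q)"
    by (simp add: m_def scal_simps)
qed

theorem proposition7p4:
  fixes q :: "'k::field" and i :: 4
  assumes "q \<noteq> 0" and "q ^ 2 \<noteq> 1"
  shows "\<exists>h \<in> alg_hom (uq_algebra q) (tet_algebra q).
    h (eq_x q) = tet_x q i (i + 2) \<and>
    h (eq_x_inv q) = tet_x q (i + 2) i \<and>
    h (eq_y q) = tet_x q (i + 2) (i + 3) \<and>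
    h (eq_z q) = tet_x q (i + 3) i"
proof -
  let ?I = "rel_ideal (tet_relators q)"
  define x x' y z :: "(tet_index, 'k) free_alg" where
    "x = tet_gen i (i + 2)" and "x' = tet_gen (i + 2) i"
    and "y = tet_gen (i + 2) (i + 3)" and "z = tet_gen (i + 3) i"
  \<comment> \<open>Under \<open>f\<close>, the element \<open>K\<^sup>-\<^sup>1 + e\<^sup>-\<close> goes to \<open>y\<close>, and \<open>K\<^sup>-\<^sup>1 - c K\<^sup>-\<^sup>1 e\<^sup>+\<close> goes to
    \<open>x' x z\<close>, which is congruent to \<open>z\<close>.\<close>
  define c where "c = q * (q - inverse q) ^ 2"
  define f where "f g = (case g of GK \<Rightarrow> x | GKinv \<Rightarrow> x'
      | Gep \<Rightarrow> scal (inverse c) * (1 - x * z) | Gem \<Rightarrow> y - x')" for g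
  define s s' :: "(tet_index, 'k) free_alg" where "s = scal q" and "s' = scal (inverse q)"
  have q: "q - inverse q \<noteq> 0"
    using assms by (auto simp: field_simps power2_eq_square)
  then have c: "c \<noteq> 0"
    using assms(1) by (simp add: c_def)
  have s: "p * s = s * p" "p * s' = s' * p" "s * s' = 1" for p
    using assms(1) by (simp_all add: s_def s'_def scal_commute[of p] scal_simps(2,4)[symmetric])

  have steps: "i + 2 - i = 2" "i - (i + 2) = 2" "i + 3 - (i + 2) = 1" "i - (i + 3) = 1"
    by simp_all
  note tet_equitable = tet_equitable[OF _ assms, folded s_def s'_def]
  have a: "x * x' - 1 \<in> ?I" and b: "x' * x - 1 \<in> ?I"
    unfolding x_def x'_def by (rule tet_inverse, simp)+
  have r1: "s * x * y - s' * y * x - (s - s') \<in> ?I"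
    unfolding x_def y_def by (rule tet_equitable) (simp only: steps, simp)
  have r2: "s * y * z - s' * z * y - (s - s') \<in> ?I"
    unfolding y_def z_def by (rule tet_equitable) (simp only: steps, simp)
  have r3: "s * z * x - s' * x * z - (s - s') \<in> ?I"
    unfolding z_def x_def by (rule tet_equitable) (simp only: steps, simp)
  note closed = rel_ideal_add rel_ideal_diff rel_ideal_mult_left rel_ideal_mult_right a b r1 r2 r3

  have raise: "x * (1 - x * z) * x' - s * s * (1 - x * z) \<in> ?I"
    unfolding chevalley_relations(1)[OF s] by (intro closed)
  have lower: "x * (y - x') * x' - s' * s' * (y - x') \<in> ?I"
    unfolding chevalley_relations(2)[OF s] by (intro closed)
  have comm: "(1 - x * z) * (y - x') - (y - x') * (1 - x * z) - (s * s - 1) * (x - x') \<in> ?I"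
    unfolding chevalley_relations(3)[OF s] by (intro closed)

  have left: "p * (scal d * r) = scal d * (p * r)" for p r :: "(tet_index, 'k) free_alg" and d
    by (simp add: mult.assoc [symmetric] scal_commute)
  note move = left[of x] left[of x'] left[of y] left[of s]
    scal_commute[of x] scal_commute[of x'] scal_commute[of y] scal_commute[of s]
  have "subst f r \<in> ?I" if "r \<in> uq_relators q" for r
  proof -
    from that consider "r = gen GK * gen GKinv - 1" | "r = gen GKinv * gen GK - 1"
      | "r = gen GK * gen Gep * gen GKinv - scal (q powi 2) * gen Gep"
      | "r = gen GK * gen Gem * gen GKinv - scal (q powi (- 2)) * gen Gem"
      | "r = (gen Gep * gen Gem - gen Gem * gen Gep)
          - scal (inverse (q - inverse q)) * (gen GK - gen GKinv)"
      unfolding uq_relators_def by blast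
    then show ?thesis
    proof cases
      case 1
      then show ?thesis using a by (simp add: f_def)
    next
      case 2
      then show ?thesis using b by (simp add: f_def)
    next
      case 3
      have "scal (q powi 2) = s * s"
        by (simp add: s_def scal_simps(4)[symmetric] power2_eq_square)
      with 3 have "subst f r = x * (scal (inverse c) * (1 - x * z)) * x'
          - s * s * (scal (inverse c) * (1 - x * z))"
        by (simp add: f_def)
      also have "\<dots> = scal (inverse c) * (x * (1 - x * z) * x' - s * s * (1 - x * z))"
        by (simp add: algebra_simps move)
      finally show ?thesis using rel_ideal_mult_left[OF raise] by simp
    next
      case 4
      have "scal (q powi (- 2)) = s' * s'"
        by (simp add: s'_def scal_simps(4)[symmetric] power_int_minus power2_eq_square)
      with 4 show ?thesis using lower by (simp add: f_def)
    next
      case 5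
      \<comment> \<open>As \<open>q\<^sup>2 - 1 = q (q - q\<^sup>-\<^sup>1)\<close>, this is where the factor \<open>q\<close> in \<open>c\<close> is needed.\<close>
      have "inverse (q - inverse q) = inverse c * (q * q - 1)"
        using q c assms(1) by (simp add: c_def field_simps power2_eq_square)
      then have "scal (inverse (q - inverse q)) = scal (inverse c) * (s * s - 1)"
        by (simp add: scal_simps s_def)
      with 5 have "subst f r = scal (inverse c) * (1 - x * z) * (y - x')
          - (y - x') * (scal (inverse c) * (1 - x * z)) - scal (inverse c) * (s * s - 1) * (x - x')"
        by (simp add: f_def)
      also have "\<dots> = scal (inverse c) *
          ((1 - x * z) * (y - x') - (y - x') * (1 - x * z) - (s * s - 1) * (x - x'))"
        by (simp add: algebra_simps move)
      finally show ?thesis using rel_ideal_mult_left[OF comm] by simp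
    qed
  qed
  then obtain h where h: "h \<in> alg_hom (uq_algebra q) (tet_algebra q)"
      "\<And>p. h (pres_class (uq_relators q) p) = pres_class (tet_relators q) (subst f p)"
    unfolding uq_algebra_def tet_algebra_def using presented_algebra_hom by metis
  have "x' * (scal (inverse c) * (1 - x * z)) * scal c = scal c * (scal (inverse c) * (x' * (1 - x * z)))"
    by (simp only: left[of x'] scal_commute[of _ c])
  also have "\<dots> = x' * (1 - x * z)"
    using c by (simp add: mult.assoc [symmetric] scal_simps(2) scal_simps(4) [symmetric])
  finally have "x' * (scal (inverse c) * (1 - x * z)) * scal c = x' * (1 - x * z)" .
  then have "subst f (gen GKinv - gen GKinv * gen Gep * scal c) - z = (x' * x - 1) * z"
    by (simp add: f_def algebra_simps)
  then have "h (eq_z q) = pres_class (tet_relators q) z"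
    using b by (simp add: eq_z_def h(2) pres_class_eq_iff rel_ideal_mult_right c_def[symmetric])
  moreover have "h (eq_x q) = pres_class (tet_relators q) x"
      "h (eq_x_inv q) = pres_class (tet_relators q) x'"
      "h (eq_y q) = pres_class (tet_relators q) y"
    by (simp_all add: eq_x_def eq_x_inv_def eq_y_def h(2) f_def)
  ultimately show ?thesis
    using h(1) unfolding tet_x_def x_def x'_def y_def z_def by blast
qed

end
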